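(* Let $\mathbf P=(P,\leq,{}',0,1)$ be a bounded poset with a unary operation and let $\mathbf L=(P,\sqcup,\sqcap,{}',0,1)$ be a $\lambda$-lattice assigned to $\mathbf P$. Then $\mathbf P$ is complemented if and only if $\mathbf L$ satisfies the identities $$(x\sqcup y)\sqcup(x'\sqcup y)\approx 1,$$ $$(x\sqcap y)\sqcap(x'\sqcap y)\approx 0 .$$ Hence the class $\mathcal{L}c$ of all bounded $\lambda$-lattices $\mathbf L$ with a unary operation such that the poset $\mathbb P(\mathbf L)$ is complemented is a variety.
   Context: A bounded poset with a unary operation is a structure $\mathbf P=(P,\leq,{}',0,1)$ where $(P,\leq)$ is a poset with least element $0$ and greatest element $1$ and ${}'$ is an arbitrary unary operation on $P$. For $a,b\in P$, $a\vee b$ denotes $\sup(a,b)$ and $a\wedge b$ denotes $\inf(a,b)$, whenever these exist; $U(a,b)=\{x\in P\mid a,b\leq x\}$ and $L(a,b)=\{x\in P\mid x\leq a,b\}$. $\mathbf P$ is complemented if for every $x\in P$ the elements $x\vee x'$ and $x\wedge x'$ exist with $x\vee x'=1$ and $x\wedge x'=0$. A bounded $\lambda$-lattice is an algebra $(L,\sqcup,\sqcap,0,1)$ of type $(2,2,0,0)$ satisfying the identities $x\sqcup y\approx y\sqcup x$, $x\sqcap y\approx y\sqcap x$, $x\sqcup((x\sqcup y)\sqcup z)\approx(x\sqcup y)\sqcup z$, $x\sqcap((x\sqcap y)\sqcap z)\approx(x\sqcap y)\sqcap z$, $x\sqcup(x\sqcap y)\approx x$, $x\sqcap(x\sqcup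 y)\approx x$, $x\sqcup0\approx x$, $x\sqcup1\approx1$. A bounded $\lambda$-lattice with a unary operation is an algebra $(L,\sqcup,\sqcap,{}',0,1)$ such that $(L,\sqcup,\sqcap,0,1)$ is a bounded $\lambda$-lattice and ${}'$ is an arbitrary unary operation on $L$. A $\lambda$-lattice assigned to $\mathbf P$ is any algebra $(P,\sqcup,\sqcap,{}',0,1)$ (with the same ${}',0,1$) such that for all $x,y\in P$: if $x\vee y$ exists then $x\sqcup y=x\vee y$, otherwise $x\sqcup y=y\sqcup x$ is an arbitrarily chosen element of $U(x,y)$; if $x\wedge y$ exists then $x\sqcap y=x\wedge y$, otherwise $x\sqcap y=y\sqcap x$ is an arbitrarily chosen element of $L(x,y)$. Every such algebra is a bounded $\lambda$-lattice with a unary operation. For a bounded $\lambda$-lattice $\mathbf L=(L,\sqcup,\sqcap,{}',0,1)$ with a unary operation, $\mathbb P(\mathbf L)=(L,\leq,{}',0,1)$ is the bounded poset with a unary operation given by $x\leq y$ iff $x\sqcup y=y$ (equivalently $x\sqcap y=x$). A variety is a class of algebras of the given type defined by a set of identities. *)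

theory Defs
  imports "HOL-Algebra.Lattice"
begin

section \<open>Bounded posets with a unary operation\<close>

record 'a uposet = "'a gorder" +
  pcompl :: "'a \<Rightarrow> 'a"
  pzero :: 'a
  pone :: 'a

definition bounded_uposet :: "'a uposet \<Rightarrow> bool" where
  "bounded_uposet P \<longleftrightarrow>
     partial_order P \<and> pcompl P \<in> carrier P \<rightarrow> carrier P \<and>
     least P (pzero P) (carrier P) \<and> greatest P (pone P) (carrier P)"

text \<open>The library operations \<open>\<squnion>\<^bsub>P\<^esub>\<close> and \<open>\<sqinter>\<^bsub>P\<^esub>\<close> select a supremum and an infimum by Hilbert choice,
  so they are meaningful only together with the following existence predicates.\<close>

definition sup_exists :: "'a uposet \<Rightarrow> 'a \<Rightarrow> 'a \<Rightarrow> bool" where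
  "sup_exists P x y \<longleftrightarrow> (\<exists>s. is_lub P s {x, y})"

definition inf_exists :: "'a uposet \<Rightarrow> 'a \<Rightarrow> 'a \<Rightarrow> bool" where
  "inf_exists P x y \<longleftrightarrow> (\<exists>i. is_glb P i {x, y})"

definition complemented :: "'a uposet \<Rightarrow> bool" where
  "complemented P \<longleftrightarrow>
     (\<forall>x \<in> carrier P.
        sup_exists P x (pcompl P x) \<and> x \<squnion>\<^bsub>P\<^esub> pcompl P x = pone P \<and>
        inf_exists P x (pcompl P x) \<and> x \<sqinter>\<^bsub>P\<^esub> pcompl P x = pzero P)"

section \<open>Algebras of type (2,2,1,0,0), identities and varieties\<close>

record 'a ualgebra = "'a partial_object" +
  ajoin :: "'a \<Rightarrow> 'a \<Rightarrow> 'a"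
  ameet :: "'a \<Rightarrow> 'a \<Rightarrow> 'a"
  acompl :: "'a \<Rightarrow> 'a"
  azero :: 'a
  aone :: 'a

definition is_ualgebra :: "'a ualgebra \<Rightarrow> bool" where
  "is_ualgebra A \<longleftrightarrow>
     (\<forall>x \<in> carrier A. \<forall>y \<in> carrier A. ajoin A x y \<in> carrier A \<and> ameet A x y \<in> carrier A) \<and>
     (\<forall>x \<in> carrier A. acompl A x \<in> carrier A) \<and>
     azero A \<in> carrier A \<and> aone A \<in> carrier A"

datatype uterm =
    Var nat
  | Join uterm uterm (infixl \<open>\<^bold>\<squnion>\<close> 65)
  | Meet uterm uterm (infixl \<open>\<^bold>\<sqinter>\<close> 70)
  | Compl uterm
  | Zero (\<open>\<^bold>0\<close>)
  | One (\<open>\<^bold>1\<close>)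

primrec value_of :: "'a ualgebra \<Rightarrow> (nat \<Rightarrow> 'a) \<Rightarrow> uterm \<Rightarrow> 'a" where
  "value_of A v (Var n) = v n"
| "value_of A v (s \<^bold>\<squnion> t) = ajoin A (value_of A v s) (value_of A v t)"
| "value_of A v (s \<^bold>\<sqinter> t) = ameet A (value_of A v s) (value_of A v t)"
| "value_of A v (Compl t) = acompl A (value_of A v t)"
| "value_of A v \<^bold>0 = azero A"
| "value_of A v \<^bold>1 = aone A"

type_synonym identity = "uterm \<times> uterm"

abbreviation identity_of :: "uterm \<Rightarrow> uterm \<Rightarrow> identity" (infix \<open>\<^bold>\<approx>\<close> 50) where
  "s \<^bold>\<approx> t \<equiv> (s, t)"

definition satisfies :: "'a ualgebra \<Rightarrow> identity \<Rightarrow> bool" where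
  "satisfies A e \<longleftrightarrow>
     (\<forall>v. range v \<subseteq> carrier A \<longrightarrow> value_of A v (fst e) = value_of A v (snd e))"

definition models :: "identity set \<Rightarrow> 'a ualgebra set" where
  "models E = {A. is_ualgebra A \<and> (\<forall>e \<in> E. satisfies A e)}"

text \<open>Classes of algebras are represented by sets of algebras with carriers inside an arbitrary
  type \<open>'a\<close>. A set of identities does not mention that type.\<close>

definition variety :: "'a ualgebra set \<Rightarrow> bool" where
  "variety K \<longleftrightarrow> (\<exists>E. K = models E)"

section \<open>Bounded \<open>\<lambda>\<close>-lattices with a unary operation\<close>

abbreviation "X \<equiv> Var 0"
abbreviation "Y \<equiv> Var 1"
abbreviation "Z \<equiv> Var 2"

definition lambda_identities :: "identity set" where
  "lambda_identities =
     {X \<^bold>\<squnion> Y \<^bold>\<approx> Y \<^bold>\<squnion> X,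
      X \<^bold>\<sqinter> Y \<^bold>\<approx> Y \<^bold>\<sqinter> X,
      X \<^bold>\<squnion> ((X \<^bold>\<squnion> Y) \<^bold>\<squnion> Z) \<^bold>\<approx> (X \<^bold>\<squnion> Y) \<^bold>\<squnion> Z,
      X \<^bold>\<sqinter> ((X \<^bold>\<sqinter> Y) \<^bold>\<sqinter> Z) \<^bold>\<approx> (X \<^bold>\<sqinter> Y) \<^bold>\<sqinter> Z,
      X \<^bold>\<squnion> (X \<^bold>\<sqinter> Y) \<^bold>\<approx> X,
      X \<^bold>\<sqinter> (X \<^bold>\<squnion> Y) \<^bold>\<approx> X,
      X \<^bold>\<squnion> \<^bold>0 \<^bold>\<approx> X,
      X \<^bold>\<squnion> \<^bold>1 \<^bold>\<approx> \<^bold>1}"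

definition bounded_ulambda_lattice :: "'a ualgebra \<Rightarrow> bool" where
  "bounded_ulambda_lattice L \<longleftrightarrow>
     is_ualgebra L \<and> (\<forall>e \<in> lambda_identities. satisfies L e)"

definition assigned :: "'a uposet \<Rightarrow> 'a ualgebra \<Rightarrow> bool" where
  "assigned P L \<longleftrightarrow>
     carrier L = carrier P \<and> azero L = pzero P \<and> aone L = pone P \<and>
     (\<forall>x \<in> carrier P. acompl L x = pcompl P x) \<and>
     (\<forall>x \<in> carrier P. \<forall>y \<in> carrier P.
        (if sup_exists P x y then ajoin L x y = x \<squnion>\<^bsub>P\<^esub> y
         else ajoin L x y = ajoin L y x \<and> ajoin L x y \<in> Upper P {x, y}) \<and>
        (if inf_exists P x y then ameet L x y = x \<sqinter>\<^bsub>P\<^esub> y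
         else ameet L x y = ameet L y x \<and> ameet L x y \<in> Lower P {x, y}))"

definition induced_poset :: "'a ualgebra \<Rightarrow> 'a uposet" (\<open>\<P>\<close>) where
  "\<P> L = \<lparr>carrier = carrier L, eq = (=), le = (\<lambda>x y. ajoin L x y = y),
          pcompl = acompl L, pzero = azero L, pone = aone L\<rparr>"

definition Lc :: "'a ualgebra set" where
  "Lc = {L. bounded_ulambda_lattice L \<and> complemented (\<P> L)}"

end

theory Submission
  imports Defs
begin

text \<open>The element \<open>(x \<squnion> y) \<squnion> (x' \<squnion> y)\<close> is an upper bound of \<open>x\<close> and \<open>x'\<close>, so it is \<open>1\<close> if \<open>x \<or> x' = 1\<close>.
  Conversely, every upper bound \<open>z\<close> of \<open>x\<close> and \<open>x'\<close> satisfies \<open>(x \<squnion> z) \<squnion> (x' \<squnion> z) = z \<squnion> z = z\<close>, so the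
  identity forces \<open>z = 1\<close>. Only two facts about \<open>\<squnion>\<close> matter: \<open>x \<squnion> y\<close> is an upper bound, and
  \<open>x \<squnion> y = y\<close> for \<open>x \<le> y\<close>.\<close>

section \<open>Identities in few variables and retractions\<close>

text \<open>Chosen elements of \<open>C\<close> extend to a valuation by sending all remaining
  variables to the last of them. An empty \<open>C\<close> makes both sides vacuous.\<close>

lemma valuation2:
  "(\<forall>v. range v \<subseteq> C \<longrightarrow> Q (v 0) (v (1::nat))) \<longleftrightarrow> (\<forall>x \<in> C. \<forall>y \<in> C. Q x y)"
proof (intro iffI ballI)
  fix x y
  assume "\<forall>v. range v \<subseteq> C \<longrightarrow> Q (v 0) (v (1::nat))" "x \<in> C" "y \<in> C"
  then show "Q x y"
    by (auto dest: spec[of _ "\<lambda>n. if n = 0 then x else y"])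
qed (auto simp: image_subset_iff)

lemma valuation3:
  "(\<forall>v. range v \<subseteq> C \<longrightarrow> Q (v 0) (v 1) (v (2::nat))) \<longleftrightarrow> (\<forall>x \<in> C. \<forall>y \<in> C. \<forall>z \<in> C. Q x y z)"
proof (intro iffI ballI)
  fix x y z
  assume "\<forall>v. range v \<subseteq> C \<longrightarrow> Q (v 0) (v 1) (v (2::nat))" "x \<in> C" "y \<in> C" "z \<in> C"
  then show "Q x y z"
    by (auto dest: spec[of _ "\<lambda>n. if n = 0 then x else if n = 1 then y else z"])
qed (auto simp: image_subset_iff)

text \<open>A map that sends \<open>A\<close> into \<open>U\<close> and fixes \<open>U\<close>
  pointwise has image exactly \<open>U\<close>. Below, \<open>A\<close> is the carrier,
  \<open>U\<close> the common upper or lower bounds of \<open>x\<close> and \<open>x'\<close>, and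
  \<open>f\<close> the left side of an identity as a function of \<open>y\<close>.\<close>

lemma retraction_constant_iff:
  assumes "c \<in> U" "U \<subseteq> A" "\<And>y. y \<in> A \<Longrightarrow> f y \<in> U" "\<And>y. y \<in> U \<Longrightarrow> f y = y"
  shows "(\<forall>y \<in> A. f y = c) \<longleftrightarrow> U = {c}"
proof
  assume "\<forall>y \<in> A. f y = c"
  then have "y = c" if "y \<in> U" for y
    using assms(2) assms(4)[OF that] that by auto
  with assms(1) show "U = {c}"
    by blast
qed (use assms(3) in blast)

section \<open>Complementedness in terms of sets of bounds\<close>

lemma mem_Upper_pair:
  "x \<in> carrier P \<Longrightarrow> y \<in> carrier P \<Longrightarrow>
     u \<in> Upper P {x, y} \<longleftrightarrow> u \<in> carrier P \<and> x \<sqsubseteq>\<^bsub>P\<^esub> u \<and> y \<sqsubseteq>\<^bsub>P\<^esub> u"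
  by (auto simp: Upper_def)

lemma mem_Lower_pair:
  "x \<in> carrier P \<Longrightarrow> y \<in> carrier P \<Longrightarrow>
     u \<in> Lower P {x, y} \<longleftrightarrow> u \<in> carrier P \<and> u \<sqsubseteq>\<^bsub>P\<^esub> x \<and> u \<sqsubseteq>\<^bsub>P\<^esub> y"
  by (auto simp: Lower_def)

text \<open>Least upper bounds are unique, so the Hilbert choice in the library join can only return
  \<open>s\<close>.\<close>

lemma (in partial_order) join_eq_lub:
  assumes "is_lub L s {x, y}"
  shows "x \<squnion> y = s"
  unfolding join_def sup_def
  using assms by (rule some_equality) (blast intro: least_unique assms)

lemma (in partial_order) meet_eq_glb:
  assumes "is_glb L i {x, y}"
  shows "x \<sqinter> y = i"
  unfolding meet_def inf_def
  using assms by (rule some_equality) (blast intro: greatest_unique assms)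

text \<open>The top is always an upper bound and lies above all others, so it is the least one
  exactly when it is the only one; dually for the bottom. This form fits
  \<open>retraction_constant_iff\<close>.\<close>

lemma complemented_iff:
  assumes "bounded_uposet P"
  shows "complemented P \<longleftrightarrow>
    (\<forall>x \<in> carrier P. Upper P {x, pcompl P x} = {pone P} \<and> Lower P {x, pcompl P x} = {pzero P})"
  unfolding complemented_def
proof (rule ball_cong[OF HOL.refl])
  interpret partial_order P
    using assms by (simp add: bounded_uposet_def)
  fix x assume x: "x \<in> carrier P"
  define y where "y = pcompl P x"
  have y: "y \<in> carrier P"
    using assms x by (auto simp: bounded_uposet_def y_def)
  have one: "pone P \<in> Upper P {x, y}" "\<And>u. u \<in> Upper P {x, y} \<Longrightarrow> u \<sqsubseteq>\<^bsub>P\<^esub> pone P"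
    and zero: "pzero P \<in> Lower P {x, y}" "\<And>u. u \<in> Lower P {x, y} \<Longrightarrow> pzero P \<sqsubseteq>\<^bsub>P\<^esub> u"
    using assms x y
    by (auto simp: bounded_uposet_def least_def greatest_def mem_Upper_pair mem_Lower_pair)
  \<comment> \<open>Existence and value of the supremum merge into one statement free of
    choice.\<close>
  have "sup_exists P x y \<and> x \<squnion>\<^bsub>P\<^esub> y = pone P \<longleftrightarrow> is_lub P (pone P) {x, y}"
    unfolding sup_exists_def by (metis join_eq_lub)
  also have "\<dots> \<longleftrightarrow> Upper P {x, y} = {pone P}"
  proof
    assume lub: "is_lub P (pone P) {x, y}"
    have "u = pone P" if "u \<in> Upper P {x, y}" for u
      using le_antisym[OF one(2)[OF that] least_le[OF lub that]] that one(1)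
      by (auto simp: mem_Upper_pair x y)
    with one(1) show "Upper P {x, y} = {pone P}"
      by blast
  next
    assume "Upper P {x, y} = {pone P}"
    then show "is_lub P (pone P) {x, y}"
      using one Upper_closed[of P "{x, y}"] by (auto simp: least_def)
  qed
  finally have sup: "sup_exists P x y \<and> x \<squnion>\<^bsub>P\<^esub> y = pone P \<longleftrightarrow> Upper P {x, y} = {pone P}" .
  have "inf_exists P x y \<and> x \<sqinter>\<^bsub>P\<^esub> y = pzero P \<longleftrightarrow> is_glb P (pzero P) {x, y}"
    unfolding inf_exists_def by (metis meet_eq_glb)
  also have "\<dots> \<longleftrightarrow> Lower P {x, y} = {pzero P}"
  proof
    assume glb: "is_glb P (pzero P) {x, y}"
    have "u = pzero P" if "u \<in> Lower P {x, y}" for u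
      using le_antisym[OF greatest_le[OF glb that] zero(2)[OF that]] that zero(1)
      by (auto simp: mem_Lower_pair x y)
    with zero(1) show "Lower P {x, y} = {pzero P}"
      by blast
  next
    assume "Lower P {x, y} = {pzero P}"
    then show "is_glb P (pzero P) {x, y}"
      using zero Lower_closed[of P "{x, y}"] by (auto simp: greatest_def)
  qed
  finally have inf: "inf_exists P x y \<and> x \<sqinter>\<^bsub>P\<^esub> y = pzero P \<longleftrightarrow> Lower P {x, y} = {pzero P}" .
  from sup inf show "(sup_exists P x (pcompl P x) \<and> x \<squnion>\<^bsub>P\<^esub> pcompl P x = pone P \<and>
      inf_exists P x (pcompl P x) \<and> x \<sqinter>\<^bsub>P\<^esub> pcompl P x = pzero P) \<longleftrightarrow>
      Upper P {x, pcompl P x} = {pone P} \<and> Lower P {x, pcompl P x} = {pzero P}"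
    unfolding y_def by argo
qed

section \<open>The equivalence for order-compatible operations\<close>

text \<open>Weaker than \<open>assigned\<close>: in the poset induced by a \<open>\<lambda>\<close>-lattice, \<open>x \<squnion> y\<close> need not be the
  supremum of \<open>x\<close> and \<open>y\<close> even if that supremum exists.\<close>

locale order_compatible =
  fixes P :: "'a uposet" and L :: "'a ualgebra"
  assumes bounded: "bounded_uposet P"
    and carrier_eq: "carrier L = carrier P"
    and zero_eq: "azero L = pzero P"
    and one_eq: "aone L = pone P"
    and compl_eq: "x \<in> carrier P \<Longrightarrow> acompl L x = pcompl P x"
    and join_Upper: "x \<in> carrier P \<Longrightarrow> y \<in> carrier P \<Longrightarrow> ajoin L x y \<in> Upper P {x, y}"
    and meet_Lower: "x \<in> carrier P \<Longrightarrow> y \<in> carrier P \<Longrightarrow> ameet L x y \<in> Lower P {x, y}"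
    and join_absorb: "x \<in> carrier P \<Longrightarrow> y \<in> carrier P \<Longrightarrow> x \<sqsubseteq>\<^bsub>P\<^esub> y \<Longrightarrow> ajoin L x y = y"
    and meet_absorb: "x \<in> carrier P \<Longrightarrow> y \<in> carrier P \<Longrightarrow> y \<sqsubseteq>\<^bsub>P\<^esub> x \<Longrightarrow> ameet L x y = y"
begin

sublocale partial_order P
  using bounded by (simp add: bounded_uposet_def)

lemma pcompl_closed: "x \<in> carrier P \<Longrightarrow> pcompl P x \<in> carrier P"
  using bounded by (auto simp: bounded_uposet_def)

lemma pone_Upper: "x \<in> carrier P \<Longrightarrow> y \<in> carrier P \<Longrightarrow> pone P \<in> Upper P {x, y}"
  using bounded by (auto simp: bounded_uposet_def greatest_def Upper_def)

lemma pzero_Lower: "x \<in> carrier P \<Longrightarrow> y \<in> carrier P \<Longrightarrow> pzero P \<in> Lower P {x, y}"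
  using bounded by (auto simp: bounded_uposet_def least_def Lower_def)

text \<open>For fixed \<open>x\<close>, the left side of the identity retracts the carrier onto the
  upper bounds of \<open>x\<close> and \<open>x'\<close>, which eliminates the quantifier over
  \<open>y\<close>.\<close>

lemma join_identity_iff:
  "satisfies L ((X \<^bold>\<squnion> Y) \<^bold>\<squnion> (Compl X \<^bold>\<squnion> Y) \<^bold>\<approx> \<^bold>1) \<longleftrightarrow>
     (\<forall>x \<in> carrier P. Upper P {x, pcompl P x} = {pone P})"
proof -
  have "satisfies L ((X \<^bold>\<squnion> Y) \<^bold>\<squnion> (Compl X \<^bold>\<squnion> Y) \<^bold>\<approx> \<^bold>1) \<longleftrightarrow>
      (\<forall>x \<in> carrier P. \<forall>y \<in> carrier P.
         ajoin L (ajoin L x y) (ajoin L (pcompl P x) y) = pone P)"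
    using valuation2[of "carrier P" "\<lambda>x y. ajoin L (ajoin L x y) (ajoin L (acompl L x) y) = pone P"]
    by (simp add: satisfies_def carrier_eq one_eq compl_eq)
  also have "\<dots> \<longleftrightarrow> (\<forall>x \<in> carrier P. Upper P {x, pcompl P x} = {pone P})"
  proof (rule ball_cong[OF HOL.refl])
    fix x assume x: "x \<in> carrier P"
    note x' = pcompl_closed[OF x]
    \<comment> \<open>\<open>x\<close> and \<open>x'\<close> lie below the two inner joins, and
      these below the outer one.\<close>
    have "ajoin L (ajoin L x y) (ajoin L (pcompl P x) y) \<in> Upper P {x, pcompl P x}"
      if "y \<in> carrier P" for y
    proof -
      have "ajoin L x y \<in> Upper P {x, y}" "ajoin L (pcompl P x) y \<in> Upper P {pcompl P x, y}"
        using join_Upper x x' that by auto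
      with join_Upper[of "ajoin L x y" "ajoin L (pcompl P x) y"] x x' that show ?thesis
        by (auto simp: mem_Upper_pair intro: le_trans)
    qed
    \<comment> \<open>Both inner joins collapse to \<open>z\<close>; the outer one is then
      \<open>z\<close> joined with itself, which reflexivity settles.\<close>
    moreover have "ajoin L (ajoin L x z) (ajoin L (pcompl P x) z) = z"
      if "z \<in> Upper P {x, pcompl P x}" for z
      using that x x' by (simp add: mem_Upper_pair join_absorb)
    ultimately show "(\<forall>y \<in> carrier P. ajoin L (ajoin L x y) (ajoin L (pcompl P x) y) = pone P) \<longleftrightarrow>
        Upper P {x, pcompl P x} = {pone P}"
      by (intro retraction_constant_iff pone_Upper Upper_closed x x')
  qed
  finally show ?thesis .
qed

text \<open>Order dual of \<open>join_identity_iff\<close>, with a retraction onto the lower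
  bounds.\<close>

lemma meet_identity_iff:
  "satisfies L ((X \<^bold>\<sqinter> Y) \<^bold>\<sqinter> (Compl X \<^bold>\<sqinter> Y) \<^bold>\<approx> \<^bold>0) \<longleftrightarrow>
     (\<forall>x \<in> carrier P. Lower P {x, pcompl P x} = {pzero P})"
proof -
  have "satisfies L ((X \<^bold>\<sqinter> Y) \<^bold>\<sqinter> (Compl X \<^bold>\<sqinter> Y) \<^bold>\<approx> \<^bold>0) \<longleftrightarrow>
      (\<forall>x \<in> carrier P. \<forall>y \<in> carrier P.
         ameet L (ameet L x y) (ameet L (pcompl P x) y) = pzero P)"
    using valuation2[of "carrier P" "\<lambda>x y. ameet L (ameet L x y) (ameet L (acompl L x) y) = pzero P"]
    by (simp add: satisfies_def carrier_eq zero_eq compl_eq)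
  also have "\<dots> \<longleftrightarrow> (\<forall>x \<in> carrier P. Lower P {x, pcompl P x} = {pzero P})"
  proof (rule ball_cong[OF HOL.refl])
    fix x assume x: "x \<in> carrier P"
    note x' = pcompl_closed[OF x]
    have "ameet L (ameet L x y) (ameet L (pcompl P x) y) \<in> Lower P {x, pcompl P x}"
      if "y \<in> carrier P" for y
    proof -
      have "ameet L x y \<in> Lower P {x, y}" "ameet L (pcompl P x) y \<in> Lower P {pcompl P x, y}"
        using meet_Lower x x' that by auto
      with meet_Lower[of "ameet L x y" "ameet L (pcompl P x) y"] x x' that show ?thesis
        by (auto simp: mem_Lower_pair intro: le_trans)
    qed
    moreover have "ameet L (ameet L x z) (ameet L (pcompl P x) z) = z"
      if "z \<in> Lower P {x, pcompl P x}" for z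
      using that x x' by (simp add: mem_Lower_pair meet_absorb)
    ultimately show "(\<forall>y \<in> carrier P. ameet L (ameet L x y) (ameet L (pcompl P x) y) = pzero P) \<longleftrightarrow>
        Lower P {x, pcompl P x} = {pzero P}"
      by (intro retraction_constant_iff pzero_Lower Lower_closed x x')
  qed
  finally show ?thesis .
qed

lemma complemented_iff_identities:
  "complemented P \<longleftrightarrow>
     satisfies L ((X \<^bold>\<squnion> Y) \<^bold>\<squnion> (Compl X \<^bold>\<squnion> Y) \<^bold>\<approx> \<^bold>1) \<and>
     satisfies L ((X \<^bold>\<sqinter> Y) \<^bold>\<sqinter> (Compl X \<^bold>\<sqinter> Y) \<^bold>\<approx> \<^bold>0)"
  unfolding complemented_iff[OF bounded] join_identity_iff meet_identity_iff by blast

end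

section \<open>Assigned algebras and induced posets are order-compatible\<close>

lemma order_compatible_assigned:
  assumes "bounded_uposet P" "assigned P L"
  shows "order_compatible P L"
proof -
  interpret partial_order P
    using assms(1) by (simp add: bounded_uposet_def)
  have join: "if sup_exists P x y then ajoin L x y = x \<squnion>\<^bsub>P\<^esub> y
      else ajoin L x y = ajoin L y x \<and> ajoin L x y \<in> Upper P {x, y}"
    and meet: "if inf_exists P x y then ameet L x y = x \<sqinter>\<^bsub>P\<^esub> y
      else ameet L x y = ameet L y x \<and> ameet L x y \<in> Lower P {x, y}"
    if "x \<in> carrier P" "y \<in> carrier P" for x y
    using assms(2) that unfolding assigned_def by blast+
  show ?thesis
  proof
    fix x y assume xy: "x \<in> carrier P" "y \<in> carrier P"
    show "ajoin L x y \<in> Upper P {x, y}"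
      using join[OF xy] join_eq_lub
      by (auto simp: sup_exists_def least_def split: if_splits)
    show "ameet L x y \<in> Lower P {x, y}"
      using meet[OF xy] meet_eq_glb
      by (auto simp: inf_exists_def greatest_def split: if_splits)
    show "ajoin L x y = y" if "x \<sqsubseteq>\<^bsub>P\<^esub> y"
    proof -
      \<comment> \<open>Comparable elements have a supremum, so the arbitrary choice cannot occur
        here.\<close>
      have "is_lub P y {x, y}"
        using xy that by (auto simp: least_def mem_Upper_pair)
      with join[OF xy] join_eq_lub[OF this] show ?thesis
        by (auto simp: sup_exists_def split: if_splits)
    qed
    show "ameet L x y = y" if "y \<sqsubseteq>\<^bsub>P\<^esub> x"
    proof -
      have "is_glb P y {x, y}"
        using xy that by (auto simp: greatest_def mem_Lower_pair)
      with meet[OF xy] meet_eq_glb[OF this] show ?thesis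
        by (auto simp: inf_exists_def split: if_splits)
    qed
  qed (use assms in \<open>auto simp: assigned_def\<close>)
qed

text \<open>All eight identities share one block of three quantifiers, so that
  \<open>valuation3\<close> applies once.\<close>

lemma lambda_identities_iff:
  "(\<forall>e \<in> lambda_identities. satisfies L e) \<longleftrightarrow>
     (\<forall>x \<in> carrier L. \<forall>y \<in> carrier L. \<forall>z \<in> carrier L.
        ajoin L x y = ajoin L y x \<and> ameet L x y = ameet L y x \<and>
        ajoin L x (ajoin L (ajoin L x y) z) = ajoin L (ajoin L x y) z \<and>
        ameet L x (ameet L (ameet L x y) z) = ameet L (ameet L x y) z \<and>
        ajoin L x (ameet L x y) = x \<and> ameet L x (ajoin L x y) = x \<and>
        ajoin L x (azero L) = x \<and> ajoin L x (aone L) = aone L)"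
  by (subst valuation3[symmetric]) (auto simp: lambda_identities_def satisfies_def)

text \<open>The induced order is defined by joins alone, so the claims about meets come from
  absorption and commutativity.\<close>

lemma order_compatible_induced:
  assumes "bounded_ulambda_lattice L"
  shows "order_compatible (\<P> L) L"
proof -
  define C where "C = carrier L"
  have closed: "ajoin L x y \<in> C" "ameet L x y \<in> C" "acompl L x \<in> C"
    if "x \<in> C" "y \<in> C" for x y
    using assms that by (auto simp: bounded_ulambda_lattice_def is_ualgebra_def C_def)
  have const: "azero L \<in> C" "aone L \<in> C"
    using assms by (auto simp: bounded_ulambda_lattice_def is_ualgebra_def C_def)
  have identities: "\<forall>x \<in> C. \<forall>y \<in> C. \<forall>z \<in> C.
        ajoin L x y = ajoin L y x \<and> ameet L x y = ameet L y x \<and>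
        ajoin L x (ajoin L (ajoin L x y) z) = ajoin L (ajoin L x y) z \<and>
        ameet L x (ameet L (ameet L x y) z) = ameet L (ameet L x y) z \<and>
        ajoin L x (ameet L x y) = x \<and> ameet L x (ajoin L x y) = x \<and>
        ajoin L x (azero L) = x \<and> ajoin L x (aone L) = aone L"
    using assms unfolding bounded_ulambda_lattice_def lambda_identities_iff C_def by blast
  have comm: "ajoin L x y = ajoin L y x" "ameet L x y = ameet L y x"
    and absorb: "ajoin L x (ameet L x y) = x" "ameet L x (ajoin L x y) = x"
    if "x \<in> C" "y \<in> C" for x y
    using identities that by blast+
  have assoc: "ajoin L x (ajoin L (ajoin L x y) z) = ajoin L (ajoin L x y) z"
    if "x \<in> C" "y \<in> C" "z \<in> C" for x y z
    using identities that by blast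
  have bounds: "ajoin L x (azero L) = x" "ajoin L x (aone L) = aone L" if "x \<in> C" for x
    using identities that by blast+
  \<comment> \<open>\<open>x\<close> equals its join with the meet of \<open>x\<close> and
    \<open>x\<close> joined with \<open>x\<close>; that meet is again \<open>x\<close>.\<close>
  have idem: "ajoin L x x = x" if "x \<in> C" for x
    using absorb[of x "ajoin L x x"] absorb(2)[of x x] closed that by metis
  have join_ge: "ajoin L x (ajoin L x y) = ajoin L x y" if "x \<in> C" "y \<in> C" for x y
    using assoc[of x x y] idem that by metis
  \<comment> \<open>The weak associativity identity is what makes the induced relation transitive:
    substitute \<open>y\<close> for the join of \<open>x\<close> and \<open>y\<close>, then
    \<open>z\<close> for that of \<open>y\<close> and \<open>z\<close>.\<close>
  have trans: "ajoin L x z = z"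
    if "x \<in> C" "y \<in> C" "z \<in> C" "ajoin L x y = y" "ajoin L y z = z" for x y z
    using assoc[of x y z] that by metis
  have poset: "partial_order (\<P> L)"
    by unfold_locales
      (auto simp: induced_poset_def C_def[symmetric] idem intro: trans dest: comm)
  have bounded: "bounded_uposet (\<P> L)"
    using poset closed const bounds comm(1)[of "azero L"]
    by (auto simp: bounded_uposet_def least_def greatest_def induced_poset_def
        C_def[symmetric])
  show ?thesis
  proof
    fix x y assume "x \<in> carrier (\<P> L)" "y \<in> carrier (\<P> L)"
    then have xy: "x \<in> C" "y \<in> C"
      by (auto simp: induced_poset_def C_def)
    show "ajoin L x y \<in> Upper (\<P> L) {x, y}"
      using join_ge[OF xy] join_ge[OF xy(2,1)] comm[OF xy] closed[OF xy] xy
      by (auto simp: Upper_def induced_poset_def C_def[symmetric])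
    show "ameet L x y \<in> Lower (\<P> L) {x, y}"
      using absorb(1)[OF xy] absorb(1)[OF xy(2,1)] comm(2)[OF xy] closed[OF xy] xy
        comm(1)[of x "ameet L x y"] comm(1)[of y "ameet L x y"]
      by (auto simp: Lower_def induced_poset_def C_def[symmetric])
    show "ajoin L x y = y" if "x \<sqsubseteq>\<^bsub>\<P> L\<^esub> y"
      using that by (simp add: induced_poset_def)
    \<comment> \<open>Here \<open>x\<close> is the join of \<open>y\<close> and \<open>x\<close>, so
      absorption makes its meet with \<open>y\<close> equal to \<open>y\<close>.\<close>
    show "ameet L x y = y" if "y \<sqsubseteq>\<^bsub>\<P> L\<^esub> x"
      using that absorb(2)[OF xy(2,1)] comm(2)[OF xy] by (simp add: induced_poset_def)
  qed (use bounded in \<open>auto simp: induced_poset_def\<close>)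
qed

section \<open>The variety of complemented \<lambda>-lattices\<close>

text \<open>Each \<lambda>-lattice is order-compatible with its own induced poset, so
  complementedness there adds just the two identities to the defining ones.\<close>

lemma Lc_eq_models:
  "Lc = models (lambda_identities \<union>
     {(X \<^bold>\<squnion> Y) \<^bold>\<squnion> (Compl X \<^bold>\<squnion> Y) \<^bold>\<approx> \<^bold>1,
      (X \<^bold>\<sqinter> Y) \<^bold>\<sqinter> (Compl X \<^bold>\<sqinter> Y) \<^bold>\<approx> \<^bold>0})"
proof -
  have "Lc = {L. bounded_ulambda_lattice L \<and>
      satisfies L ((X \<^bold>\<squnion> Y) \<^bold>\<squnion> (Compl X \<^bold>\<squnion> Y) \<^bold>\<approx> \<^bold>1) \<and>
      satisfies L ((X \<^bold>\<sqinter> Y) \<^bold>\<sqinter> (Compl X \<^bold>\<sqinter> Y) \<^bold>\<approx> \<^bold>0)}"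
    unfolding Lc_def
    using order_compatible.complemented_iff_identities[OF order_compatible_induced] by blast
  then show ?thesis
    by (auto simp: models_def bounded_ulambda_lattice_def)
qed

theorem theorem3:
  "(\<forall>(P :: 'a uposet) (L :: 'a ualgebra). bounded_uposet P \<and> assigned P L \<longrightarrow>
      (complemented P \<longleftrightarrow>
         satisfies L ((X \<^bold>\<squnion> Y) \<^bold>\<squnion> (Compl X \<^bold>\<squnion> Y) \<^bold>\<approx> \<^bold>1) \<and>
         satisfies L ((X \<^bold>\<sqinter> Y) \<^bold>\<sqinter> (Compl X \<^bold>\<sqinter> Y) \<^bold>\<approx> \<^bold>0))) \<and>
   variety (Lc :: 'a ualgebra set) \<and>
   (Lc :: 'a ualgebra set) =
     models (lambda_identities \<union>
       {(X \<^bold>\<squnion> Y) \<^bold>\<squnion> (Compl X \<^bold>\<squnion> Y) \<^bold>\<approx> \<^bold>1,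
        (X \<^bold>\<sqinter> Y) \<^bold>\<sqinter> (Compl X \<^bold>\<sqinter> Y) \<^bold>\<approx> \<^bold>0})"
proof (intro conjI allI impI; (elim conjE)?)
  fix P :: "'a uposet" and L :: "'a ualgebra"
  assume "bounded_uposet P" "assigned P L"
  then interpret order_compatible P L
    by (rule order_compatible_assigned)
  show "complemented P \<longleftrightarrow>
      satisfies L ((X \<^bold>\<squnion> Y) \<^bold>\<squnion> (Compl X \<^bold>\<squnion> Y) \<^bold>\<approx> \<^bold>1) \<and>
      satisfies L ((X \<^bold>\<sqinter> Y) \<^bold>\<sqinter> (Compl X \<^bold>\<sqinter> Y) \<^bold>\<approx> \<^bold>0)"
    by (rule complemented_iff_identities)
next
  show "variety (Lc :: 'a ualgebra set)"
    unfolding variety_def using Lc_eq_models by blast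
qed (rule Lc_eq_models)

end
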